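(* Every FA-Kotzig's nim has an outcome DFA (respectively, an SG-value DFA), under both normal and misère play. Explicitly: let $\Sigma=\{\mathbf o,\mathbf x\}$, let $\Theta$ be a finite label set, $\Delta$ a move mapping with maximum step size $s_{\max}$, $\theta_0\in\Theta$ an initial label, and $r\in\{1,2,3,\dots\}\cup\{\infty\}$ a number of laps. (i) For every outcome seed $\gamma$, the set of words $w\in\Sigma^*$ with $|w|+1>s_{\max}$ such that the position $\theta_0w$ of the $r$-lap FA-Kotzig's nim with data $(\Theta,\Delta,\gamma)$ is an $\mathcal N$-position is a regular language, and likewise for $\mathcal P$-positions; this holds under normal play and under misère play. (ii) For every SG-value seed $\gamma$ and every $g\in\mathbb N$, the set of words $w\in\Sigma^*$ with $|w|+1>s_{\max}$ such that the position $\theta_0w$ of the $r$-lap FA-Kotzig's nim with data $(\Theta,\Delta,\gamma)$ has SG value $g$ is a regular language; this holds under normal play and under misère play. This includes all impartial classical Kotzig's nim games (with any finite move set $S$ of positive integers) and all partizan classical Kotzig's nim games (with any finite move sets $S_{\mathbf L},S_{\mathbf R}$ of positive integers).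
   Context: Alphabet and labels. $\Sigma=\{\mathbf o,\mathbf x\}$, where $\mathbf o$ is an empty cell and $\mathbf x$ an obstacle. $\Theta$ is a finite set of labels. A move mapping $\Delta$ assigns to each $\theta\in\Theta$ and each word $v\mathbf o$ ($v\in\Sigma^*$) a subset $\Delta(\theta,v\mathbf o)\subseteq\Theta$, such that the set $S=\{|v\mathbf o| : \exists\theta,\ \Delta(\theta,v\mathbf o)\ne\varnothing\}$ has a finite maximum $s_{\max}=\max S$. Seeds. An outcome seed $\gamma=(\gamma_1,\dots,\gamma_{s_{\max}})$ consists of maps $\gamma_i:\Theta\to\{\mathbf x,\mathbf o_{\mathcal P},\mathbf o_{\mathcal N}\}$ such that for each $i$ either $\gamma_i(\theta)=\mathbf x$ for all $\theta$, or $\gamma_i(\theta)\neq\mathbf x$ for all $\theta$. Put $\bar\gamma_i=\mathbf x$ in the first case and $\bar\gamma_i=\mathbf o$ in the second. An SG-value seed is defined in the same way with codomain $\{\mathbf x,\mathbf o_0,\mathbf o_1,\dots,\mathbf o_{m_{\max}}\}$, where $m_{\max}$ is a fixed upper bound on the number of legal moves available from any position. FA-Kotzig's nim with $r$ laps. A position $\theta_0 w$ with $w=c_1\cdots c_{n-1}\in\Sigma^*$, $n>s_{\max}$, is a circular board with cells $0,1,\dots,n-1$; the token, carrying label $\theta_0$, is on cell $0$, and cell $j$ ($1\le j\le n-1$) is initially empty or an obstacle according to $c_j$. Unroll the board: coordinate $k$ with $0\le k<rn$ denotes cell $k \bmod n$, and (if $r<\infty$) coordinate $rn-1+i$ denotes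 the seed cell $\gamma_i$, $1\le i\le s_{\max}$ (so the seed replaces the starting cell at the end of the $r$-th lap). The token starts at coordinate $0$. Two players alternate. If the token is at coordinate $k$ with label $\theta$, let $d_j\in\Sigma$ be the current content of coordinate $k+j$ (for a seed cell $\gamma_i$ the content is $\bar\gamma_i$). A legal move consists of a step $s\in S$ with $d_s=\mathbf o$ and a label $\theta'\in\Delta(\theta,d_1\cdots d_s)$. If $k+s<rn$, the token moves to coordinate $k+s$ with label $\theta'$, and the cell it left becomes an obstacle $\mathbf x$. If $k+s=rn-1+i$ for some $i\ge 1$, the game ends: with an outcome seed the player who made the move loses if $\gamma_i(\theta')=\mathbf o_{\mathcal P}$ and wins if $\gamma_i(\theta')=\mathbf o_{\mathcal N}$; with an SG-value seed the resulting position is declared to have SG value $h$ if $\gamma_i(\theta')=\mathbf o_h$. For $r=\infty$ there is no lap restriction and the seed is never used. Outcomes. Under normal play a player with no legal move loses; under misère play a player with no legal move wins. A position is an $\mathcal N$-position if the player to move has a winning strategy, and a $\mathcal P$-position otherwise. The SG value of a position under normal play is the $\operatorname{mex}$ (least nonnegative integer not in the set) of the SG values of the positions reachable in one move (so $0$ if there are none); under misère play a position with no legal moves has value $1$ instead, and other positions have the $\operatorname{mex}$ of the values of their options. Classical games. Impartial Kotzig's nim with finite move set $S\subset\mathbb{Z}_{>0}$ is the game with $r=\infty$ (equivalently, no seed), $\Theta=\{\mathbf T\}$, $\Delta(\mathbf T,v\mathbf o)=\{\mathbf T\}$ if $|v\mathbf o|\in S$ and $\varnothing$ otherwise. Partizan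 Kotzig's nim with move sets $S_{\mathbf L},S_{\mathbf R}$ is the game with $r=\infty$, $\Theta=\{\mathbf L,\mathbf R\}$, $\Delta(\mathbf L,v\mathbf o)=\{\mathbf R\}$ if $|v\mathbf o|\in S_{\mathbf L}$, $\Delta(\mathbf R,v\mathbf o)=\{\mathbf L\}$ if $|v\mathbf o|\in S_{\mathbf R}$, and $\varnothing$ otherwise (the label records whose rules apply to the player to move). An outcome DFA is a deterministic finite automaton recognising the set of words of the $\mathcal N$-positions (or of the $\mathcal P$-positions); an SG-value DFA recognises the set of words of positions of a given SG value. *)

theory Defs
  imports Main "HOL-Library.Extended_Nat"
begin

section \<open>Deterministic finite automata\<close>

record ('q, 'a) dfa =
  states :: "'q set"
  start :: 'q
  delta :: "'q \<Rightarrow> 'a \<Rightarrow> 'q"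
  accepting :: "'q set"

definition is_dfa :: "('q, 'a) dfa \<Rightarrow> bool" where
  "is_dfa A \<longleftrightarrow> finite (states A) \<and> start A \<in> states A \<and> accepting A \<subseteq> states A \<and>
     (\<forall>q \<in> states A. \<forall>a. delta A q a \<in> states A)"

definition dfa_language :: "('q, 'a) dfa \<Rightarrow> 'a list set" where
  "dfa_language A = {w. foldl (delta A) (start A) w \<in> accepting A}"

text \<open>The state set is finite, so its elements may be taken to be natural numbers; the alphabet
  is the (finite) type of letters.\<close>

definition regular :: "('a::finite) list set \<Rightarrow> bool" where
  "regular W \<longleftrightarrow> (\<exists>A :: (nat, 'a) dfa. is_dfa A \<and> dfa_language A = W)"


section \<open>Move mappings and seeds\<close>

datatype cell = Empty | Obstacle

instance cell :: finite
proof
  show "finite (UNIV :: cell set)"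
    by (rule finite_subset[of _ "{Empty, Obstacle}"]) (auto intro: cell.exhaust)
qed

text \<open>The finite label set is a type of class \<open>finite\<close>. A move mapping is only ever
  consulted at words ending in \<open>Empty\<close>; its values at other words are irrelevant.\<close>

type_synonym 'l move_map = "'l \<Rightarrow> cell list \<Rightarrow> 'l set"

definition steps :: "'l move_map \<Rightarrow> nat set" where
  "steps \<Delta> = {length (v @ [Empty]) |v. \<exists>\<theta>. \<Delta> \<theta> (v @ [Empty]) \<noteq> {}}"

text \<open>A mapping that allows no move at all is admitted, with maximal step 0; it arises from
  classical games with empty move sets.\<close>

definition move_mapping :: "'l move_map \<Rightarrow> bool" where
  "move_mapping \<Delta> \<longleftrightarrow> finite (steps \<Delta>)"

definition max_step :: "'l move_map \<Rightarrow> nat" where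
  "max_step \<Delta> = (if steps \<Delta> = {} then 0 else Max (steps \<Delta>))"

text \<open>The moves (step, new label) that are available with label \<open>\<theta>\<close> when the cell \<open>j\<close> places
  ahead of the token has content \<open>d j\<close>.\<close>

definition legal_steps :: "'l move_map \<Rightarrow> 'l \<Rightarrow> (nat \<Rightarrow> cell) \<Rightarrow> (nat \<times> 'l) set" where
  "legal_steps \<Delta> \<theta> d =
     {(s, \<theta>'). s \<in> steps \<Delta> \<and> d s = Empty \<and> \<theta>' \<in> \<Delta> \<theta> (map d [1..<Suc s])}"

text \<open>Seed values: \<open>Blocked\<close> is the obstacle, \<open>Free v\<close> an empty cell with subscript \<open>v\<close>.
  Only the seed cells with index from 1 to the maximal step matter.\<close>

datatype 'v seed_value = Blocked | Free 'v

type_synonym ('l, 'v) seed = "nat \<Rightarrow> 'l \<Rightarrow> 'v seed_value"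

datatype outcome = Outcome_P | Outcome_N

definition is_seed :: "'l move_map \<Rightarrow> ('l, 'v) seed \<Rightarrow> bool" where
  "is_seed \<Delta> \<gamma> \<longleftrightarrow>
     (\<forall>i \<in> {1..max_step \<Delta>}. (\<forall>\<theta>. \<gamma> i \<theta> = Blocked) \<or> (\<forall>\<theta>. \<gamma> i \<theta> \<noteq> Blocked))"

text \<open>\<open>m\<close> bounds the number of legal moves from any position. Boards have more cells than
  the maximal step, so every content \<open>d\<close> of the cells within reach does occur.\<close>

definition move_bound :: "'l move_map \<Rightarrow> nat \<Rightarrow> bool" where
  "move_bound \<Delta> m \<longleftrightarrow> (\<forall>\<theta> d. card (legal_steps \<Delta> \<theta> d) \<le> m)"

definition is_sg_seed :: "'l move_map \<Rightarrow> nat \<Rightarrow> ('l, nat) seed \<Rightarrow> bool" where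
  "is_sg_seed \<Delta> m \<gamma> \<longleftrightarrow>
     is_seed \<Delta> \<gamma> \<and> (\<forall>i \<in> {1..max_step \<Delta>}. \<forall>\<theta> h. \<gamma> i \<theta> = Free h \<longrightarrow> h \<le> m)"

definition seed_content :: "('l, 'v) seed \<Rightarrow> nat \<Rightarrow> cell" where
  "seed_content \<gamma> i = (if \<forall>\<theta>. \<gamma> i \<theta> = Blocked then Obstacle else Empty)"


section \<open>The game\<close>

text \<open>\<open>Board b k \<theta>\<close>: cell contents \<open>b\<close>, token at coordinate \<open>k\<close> of the unrolled board, with
  label \<open>\<theta>\<close>. \<open>Seeded i \<theta>\<close>: the game has ended on seed cell \<open>i\<close>. The entry of \<open>b\<close> at the
  token's own cell is never read, because steps are shorter than the board.\<close>

datatype 'l position = Board "cell list" nat 'l | Seeded nat 'l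

definition on_board :: "enat \<Rightarrow> nat \<Rightarrow> nat \<Rightarrow> bool" where
  "on_board r n c \<longleftrightarrow> enat c < r * enat n"

text \<open>The \<open>i\<close> with \<open>c = r n - 1 + i\<close>; used only for finite \<open>r\<close>.\<close>

definition seed_index :: "enat \<Rightarrow> nat \<Rightarrow> nat \<Rightarrow> nat" where
  "seed_index r n c = Suc c - the_enat r * n"

definition content :: "enat \<Rightarrow> ('l, 'v) seed \<Rightarrow> cell list \<Rightarrow> nat \<Rightarrow> cell" where
  "content r \<gamma> b c =
     (if on_board r (length b) c then b ! (c mod length b)
      else seed_content \<gamma> (seed_index r (length b) c))"

fun moves :: "enat \<Rightarrow> 'l move_map \<Rightarrow> ('l, 'v) seed \<Rightarrow> 'l position \<Rightarrow> 'l position set" where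
  "moves r \<Delta> \<gamma> (Board b k \<theta>) =
     (\<lambda>(s, \<theta>'). if on_board r (length b) (k + s)
                then Board (b[k mod length b := Obstacle]) (k + s) \<theta>'
                else Seeded (seed_index r (length b) (k + s)) \<theta>')
     ` legal_steps \<Delta> \<theta> (\<lambda>j. content r \<gamma> b (k + j))"
| "moves r \<Delta> \<gamma> (Seeded i \<theta>) = {}"

definition start_position :: "'l \<Rightarrow> cell list \<Rightarrow> 'l position" where
  "start_position \<theta> w = Board (Empty # w) 0 \<theta>"

datatype convention = Normal | Misere


subsection \<open>Outcomes\<close>

text \<open>A complete play, as the list of positions passed through. Every step turns an empty cell
  into an obstacle or ends the game, so there are no infinite plays.\<close>

definition complete_play ::
  "enat \<Rightarrow> 'l move_map \<Rightarrow> ('l, 'v) seed \<Rightarrow> 'l position \<Rightarrow> 'l position list \<Rightarrow> bool" where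
  "complete_play r \<Delta> \<gamma> p ps \<longleftrightarrow>
     ps \<noteq> [] \<and> hd ps = p \<and> (\<forall>j. Suc j < length ps \<longrightarrow> ps ! Suc j \<in> moves r \<Delta> \<gamma> (ps ! j)) \<and>
     moves r \<Delta> \<gamma> (last ps) = {}"

text \<open>Whether, when the game stops at the given position, the winner is the player who is
  not to move there (the one who made the last move, if any).\<close>

fun previous_player_wins ::
  "convention \<Rightarrow> ('l, outcome) seed \<Rightarrow> 'l position \<Rightarrow> bool" where
  "previous_player_wins c \<gamma> (Board b k \<theta>) \<longleftrightarrow> c = Normal"
| "previous_player_wins c \<gamma> (Seeded i \<theta>) \<longleftrightarrow> \<gamma> i \<theta> = Free Outcome_N"

text \<open>The first player is the previous player at the end iff the number of moves made,
  \<open>length ps - 1\<close>, is odd.\<close>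

definition first_player_wins ::
  "convention \<Rightarrow> ('l, outcome) seed \<Rightarrow> 'l position list \<Rightarrow> bool" where
  "first_player_wins c \<gamma> ps \<longleftrightarrow>
     (odd (length ps - 1) \<longleftrightarrow> previous_player_wins c \<gamma> (last ps))"

text \<open>A strategy maps the history of a play (ending with the current position) to the next
  position.\<close>

definition legal_strategy ::
  "enat \<Rightarrow> 'l move_map \<Rightarrow> ('l, 'v) seed \<Rightarrow> ('l position list \<Rightarrow> 'l position) \<Rightarrow> bool" where
  "legal_strategy r \<Delta> \<gamma> \<sigma> \<longleftrightarrow>
     (\<forall>h. h \<noteq> [] \<and> moves r \<Delta> \<gamma> (last h) \<noteq> {} \<longrightarrow> \<sigma> h \<in> moves r \<Delta> \<gamma> (last h))"

definition first_player_follows ::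
  "('l position list \<Rightarrow> 'l position) \<Rightarrow> 'l position list \<Rightarrow> bool" where
  "first_player_follows \<sigma> ps \<longleftrightarrow>
     (\<forall>j. even j \<and> Suc j < length ps \<longrightarrow> ps ! Suc j = \<sigma> (take (Suc j) ps))"

definition N_position ::
  "convention \<Rightarrow> enat \<Rightarrow> 'l move_map \<Rightarrow> ('l, outcome) seed \<Rightarrow> 'l position \<Rightarrow> bool" where
  "N_position c r \<Delta> \<gamma> p \<longleftrightarrow>
     (\<exists>\<sigma>. legal_strategy r \<Delta> \<gamma> \<sigma> \<and>
        (\<forall>ps. complete_play r \<Delta> \<gamma> p ps \<and> first_player_follows \<sigma> ps \<longrightarrow>
           first_player_wins c \<gamma> ps))"

definition P_position ::
  "convention \<Rightarrow> enat \<Rightarrow> 'l move_map \<Rightarrow> ('l, outcome) seed \<Rightarrow> 'l position \<Rightarrow> bool" where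
  "P_position c r \<Delta> \<gamma> p \<longleftrightarrow> \<not> N_position c r \<Delta> \<gamma> p"


subsection \<open>SG values\<close>

definition mex :: "nat set \<Rightarrow> nat" where
  "mex A = (LEAST n. n \<notin> A)"

text \<open>The usual recursion along moves, as an inductive relation: \<open>f\<close> assigns to each option
  its SG value.\<close>

inductive has_sg_value ::
  "convention \<Rightarrow> enat \<Rightarrow> 'l move_map \<Rightarrow> ('l, nat) seed \<Rightarrow> 'l position \<Rightarrow> nat \<Rightarrow> bool"
  for c r \<Delta> \<gamma> where
  seeded: "\<gamma> i \<theta> = Free h \<Longrightarrow> has_sg_value c r \<Delta> \<gamma> (Seeded i \<theta>) h"
| stuck: "moves r \<Delta> \<gamma> (Board b k \<theta>) = {} \<Longrightarrow>
    has_sg_value c r \<Delta> \<gamma> (Board b k \<theta>) (case c of Normal \<Rightarrow> 0 | Misere \<Rightarrow> 1)"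
| moving: "moves r \<Delta> \<gamma> (Board b k \<theta>) \<noteq> {} \<Longrightarrow>
    \<forall>q \<in> moves r \<Delta> \<gamma> (Board b k \<theta>). has_sg_value c r \<Delta> \<gamma> q (f q) \<Longrightarrow>
    has_sg_value c r \<Delta> \<gamma> (Board b k \<theta>) (mex (f ` moves r \<Delta> \<gamma> (Board b k \<theta>)))"


subsection \<open>Languages of positions\<close>

definition N_words ::
  "convention \<Rightarrow> enat \<Rightarrow> 'l move_map \<Rightarrow> ('l, outcome) seed \<Rightarrow> 'l \<Rightarrow> cell list set" where
  "N_words c r \<Delta> \<gamma> \<theta>\<^sub>0 =
     {w. length w + 1 > max_step \<Delta> \<and> N_position c r \<Delta> \<gamma> (start_position \<theta>\<^sub>0 w)}"

definition P_words ::
  "convention \<Rightarrow> enat \<Rightarrow> 'l move_map \<Rightarrow> ('l, outcome) seed \<Rightarrow> 'l \<Rightarrow> cell list set" where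
  "P_words c r \<Delta> \<gamma> \<theta>\<^sub>0 =
     {w. length w + 1 > max_step \<Delta> \<and> P_position c r \<Delta> \<gamma> (start_position \<theta>\<^sub>0 w)}"

definition SG_words ::
  "convention \<Rightarrow> enat \<Rightarrow> 'l move_map \<Rightarrow> ('l, nat) seed \<Rightarrow> 'l \<Rightarrow> nat \<Rightarrow> cell list set" where
  "SG_words c r \<Delta> \<gamma> \<theta>\<^sub>0 g =
     {w. length w + 1 > max_step \<Delta> \<and> has_sg_value c r \<Delta> \<gamma> (start_position \<theta>\<^sub>0 w) g}"


section \<open>Classical Kotzig's nim\<close>

datatype impartial_label = Token

instance impartial_label :: finite
proof
  show "finite (UNIV :: impartial_label set)"
    by (rule finite_subset[of _ "{Token}"]) (auto intro: impartial_label.exhaust)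
qed

datatype partizan_label = LeftMoves | RightMoves

instance partizan_label :: finite
proof
  show "finite (UNIV :: partizan_label set)"
    by (rule finite_subset[of _ "{LeftMoves, RightMoves}"]) (auto intro: partizan_label.exhaust)
qed

fun impartial_moves :: "nat set \<Rightarrow> impartial_label move_map" where
  "impartial_moves S Token w = (if length w \<in> S then {Token} else {})"

fun partizan_moves :: "nat set \<Rightarrow> nat set \<Rightarrow> partizan_label move_map" where
  "partizan_moves S\<^sub>L S\<^sub>R LeftMoves w = (if length w \<in> S\<^sub>L then {RightMoves} else {})"
| "partizan_moves S\<^sub>L S\<^sub>R RightMoves w = (if length w \<in> S\<^sub>R then {LeftMoves} else {})"

text \<open>A placeholder for games with infinitely many laps, where the seed is never reached.\<close>

definition no_seed :: "('l, 'v) seed" where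
  "no_seed i \<theta> = Blocked"

end

theory Submission
  imports Defs
begin

text \<open>
  A game with \<open>r\<close> laps reads the board \<open>r\<close> times from left to right, but a single pass suffices,
  for the following reason. Split the board at the token into a prefix \<open>u\<close>, which is final for the
  current lap, and the rest \<open>v\<close>, and let \<open>t\<close> be the number of laps that follow the current one.
  The SG value \<open>lap_value t u v \<theta>\<close> depends on \<open>u\<close> only through the first few cells of \<open>u\<close> and
  through the way in which \<open>u\<close> influences the values at the beginning of the next lap, that is,
  through the residual at \<open>u\<close> of the function \<open>lap_values (t - 1)\<close> of the whole board
  (\<open>lap_value_cong_prefix\<close>). If that function has finitely many residuals, there are only
  finitely many functions \<open>\<lambda>u. lap_value t u v\<close>. A move goes at most the maximal step ahead, so the
  functions for the first few tails of \<open>v\<close>, together with the first few cells of \<open>v\<close>, determine the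
  function for every board that ends in \<open>v\<close> (\<open>lap_value_cong_suffix\<close>). Hence \<open>lap_values t\<close> has
  finitely many co-residuals, and then, its range being finite, finitely many residuals. So
  the finiteness of the residuals carries over from each lap to the one before it, and
  the theorem of Myhill and Nerode makes the resulting languages regular.

  Infinitely many laps reduce to finitely many. Let \<open>s\<close> be the maximal step. Each time the token
  passes the first \<open>s\<close> cells it turns one of them into an obstacle, so it never completes
  more than \<open>s\<close> laps (\<open>lap_bounded_step\<close>, \<open>lap_bounded_laps\<close>).

  Outcomes reduce to SG values: if the seed counts a win of the player who moves onto it as 0 and
  a loss as 1, the \<open>N\<close>-positions are those of nonzero value, under both conventions
  (\<open>N_position_iff_nonzero\<close>).
\<close>

section \<open>Regularity by counting residuals\<close>

lemma finite_range_if_determined: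
  assumes "finite (range \<rho>)" and "\<And>x y. \<rho> x = \<rho> y \<Longrightarrow> f x = f y"
  shows "finite (range f)"
proof -
  have "range f \<subseteq> (\<lambda>z. f (SOME x. \<rho> x = z)) ` range \<rho>"
  proof
    fix y assume "y \<in> range f"
    then obtain x where x: "y = f x" by blast
    have "\<rho> (SOME x'. \<rho> x' = \<rho> x) = \<rho> x"
      by (rule someI) simp
    then have "f (SOME x'. \<rho> x' = \<rho> x) = y"
      using assms(2) x by blast
    then show "y \<in> (\<lambda>z. f (SOME x. \<rho> x = z)) ` range \<rho>"
      by blast
  qed
  then show ?thesis
    using assms(1) finite_surj by blast
qed

text \<open>A function that factors through \<open>\<rho>\<close> is determined by the finite relation between the values of
\<open>\<rho>\<close> and its own values. The domain may be infinite.\<close>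

lemma finite_functions_through:
  assumes "finite (range \<rho>)" and "finite Y"
    and "\<And>F x. F \<in> \<F> \<Longrightarrow> F x \<in> Y"
    and "\<And>F x y. F \<in> \<F> \<Longrightarrow> \<rho> x = \<rho> y \<Longrightarrow> F x = F y"
  shows "finite \<F>"
proof (rule inj_on_finite)
  let ?graph = "\<lambda>F. range (\<lambda>x. (\<rho> x, F x))"
  show "inj_on ?graph \<F>"
  proof (rule inj_onI, rule ext)
    fix F G x
    assume FG: "F \<in> \<F>" "G \<in> \<F>" and "?graph F = ?graph G"
    then obtain y where "\<rho> x = \<rho> y" "F x = G y"
      by (auto simp: set_eq_iff image_iff)
    then show "F x = G x"
      using assms(4)[OF FG(2), of x y] by simp
  qed
  show "?graph ` \<F> \<subseteq> Pow (range \<rho> \<times> Y)"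
    using assms(3) by blast
  show "finite (Pow (range \<rho> \<times> Y))"
    using assms(1,2) by simp
qed

text \<open>Regularity for functions of words that need not be Boolean. Residuals describe what a
left-to-right reader has to remember, co-residuals what a right-to-left reader has to.\<close>

definition finite_residuals :: "('a list \<Rightarrow> 'b) \<Rightarrow> bool" where
  "finite_residuals f \<longleftrightarrow> finite (range (\<lambda>u w. f (u @ w)))"

definition finite_coresiduals :: "('a list \<Rightarrow> 'b) \<Rightarrow> bool" where
  "finite_coresiduals f \<longleftrightarrow> finite (range (\<lambda>w u. f (u @ w)))"

text \<open>The residual of \<open>f\<close> at \<open>u\<close> sends \<open>w\<close> to the value at \<open>u\<close> of the co-residual of \<open>f\<close> at \<open>w\<close>, so it
factors through the co-residuals. This is the closure of regularity under reversal of the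
reading direction, without a subset construction.\<close>

lemma finite_residuals_if_coresiduals:
  assumes "finite_coresiduals f" and "finite (range f)"
  shows "finite_residuals f"
  unfolding finite_residuals_def
proof (rule finite_functions_through)
  show "finite (range (\<lambda>w u. f (u @ w)))"
    using assms(1) by (simp add: finite_coresiduals_def)
qed (use assms(2) in \<open>auto dest: fun_cong\<close>)

text \<open>The Nerode automaton: the states are the residuals, numbered by an injection into the natural
numbers.\<close>

lemma regular_if_finite_residuals:
  fixes W :: "'a::finite list set"
  assumes "finite_residuals (\<lambda>w. w \<in> W)"
  shows "regular W"
proof -
  define res where "res = (\<lambda>u w. u @ w \<in> W)"
  have "finite (range res)"
    using assms by (simp add: finite_residuals_def res_def)
  then obtain h :: "('a list \<Rightarrow> bool) \<Rightarrow> nat" where h: "inj_on h (range res)"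
    using finite_imp_inj_to_nat_seg by blast
  define A :: "(nat, 'a) dfa" where
    "A = \<lparr>states = h ` range res, start = h (res []),
          delta = (\<lambda>q a. h (\<lambda>w. inv_into (range res) h q (a # w))),
          accepting = h ` {f \<in> range res. f []}\<rparr>"
  have delta: "delta A (h (res u)) a = h (res (u @ [a]))" for u a
    using h by (simp add: A_def) (simp add: res_def)
  have run: "foldl (delta A) (h (res u)) w = h (res (u @ w))" for u w
    by (induction w arbitrary: u) (simp_all add: delta)
  have "is_dfa A"
    unfolding is_dfa_def
  proof (intro conjI ballI allI)
    show "delta A q a \<in> states A" if "q \<in> states A" for q a
      using that delta by (auto simp: A_def)
  qed (use \<open>finite (range res)\<close> in \<open>auto simp: A_def\<close>)
  moreover have "dfa_language A = W"
  proof -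
    have "foldl (delta A) (start A) w = h (res w)" for w
      using run[of "[]" w] by (simp add: A_def)
    moreover have "h (res w) \<in> accepting A \<longleftrightarrow> w \<in> W" for w
    proof -
      have "h (res w) \<in> accepting A \<longleftrightarrow> res w []"
        using h by (auto simp: A_def dest: inj_onD)
      then show ?thesis by (simp add: res_def)
    qed
    ultimately show ?thesis by (auto simp: dfa_language_def)
  qed
  ultimately show ?thesis by (auto simp: regular_def)
qed


section \<open>Steps and SG values\<close>

lemma steps_pos: "s \<in> steps \<Delta> \<Longrightarrow> 0 < s"
  by (auto simp: steps_def)

lemma step_le_max_step: "move_mapping \<Delta> \<Longrightarrow> s \<in> steps \<Delta> \<Longrightarrow> s \<le> max_step \<Delta>"
  by (auto simp: move_mapping_def max_step_def)

lemma legal_steps_cong: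
  assumes "move_mapping \<Delta>" and "\<And>j. 0 < j \<Longrightarrow> j \<le> max_step \<Delta> \<Longrightarrow> d j = d' j"
  shows "legal_steps \<Delta> \<theta> d = legal_steps \<Delta> \<theta> d'"
proof -
  have "d s = d' s \<and> map d [1..<Suc s] = map d' [1..<Suc s]" if "s \<in> steps \<Delta>" for s
    using assms(2) step_le_max_step[OF assms(1) that] steps_pos[OF that] by auto
  then show ?thesis
    unfolding legal_steps_def by (metis (no_types, lifting))
qed

lemma finite_legal_steps:
  fixes \<Delta> :: "'l::finite move_map"
  assumes "move_mapping \<Delta>"
  shows "finite (legal_steps \<Delta> \<theta> d)"
proof (rule finite_subset)
  show "legal_steps \<Delta> \<theta> d \<subseteq> steps \<Delta> \<times> UNIV" by (auto simp: legal_steps_def)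
  show "finite (steps \<Delta> \<times> (UNIV :: 'l set))" using assms by (simp add: move_mapping_def)
qed

lemma mex_notin: "finite A \<Longrightarrow> mex A \<notin> A"
  unfolding mex_def by (rule LeastI_ex) (rule ex_new_if_finite, simp_all)

lemma less_mex: "n < mex A \<Longrightarrow> n \<in> A"
  unfolding mex_def using not_less_Least by blast

lemma mex_le_card:
  assumes "finite A"
  shows "mex A \<le> card A"
proof -
  have "{..<mex A} \<subseteq> A" using less_mex by blast
  from card_mono[OF assms this] show ?thesis by simp
qed

lemma mex_eq_0_iff:
  assumes "finite A"
  shows "mex A = 0 \<longleftrightarrow> 0 \<notin> A"
  using mex_notin[OF assms] less_mex[of 0 A] by (cases "mex A = 0") auto

lemma has_sg_value_unique:
  "has_sg_value c r \<Delta> \<gamma> p g \<Longrightarrow> has_sg_value c r \<Delta> \<gamma> p g' \<Longrightarrow> g = g'"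
proof (induction arbitrary: g' rule: has_sg_value.induct)
  case (seeded i \<theta> h)
  from seeded.prems seeded.hyps show ?case by cases auto
next
  case (stuck b k \<theta>)
  from stuck.prems stuck.hyps show ?case by cases auto
next
  case (moving b k \<theta> f)
  note IH = moving.IH
  from moving.prems show ?case
  proof cases
    case stuck
    with moving.hyps show ?thesis by blast
  next
    case (moving f')
    have "f ` moves r \<Delta> \<gamma> (Board b k \<theta>) = f' ` moves r \<Delta> \<gamma> (Board b k \<theta>)"
    proof (rule image_cong[OF refl])
      fix q assume "q \<in> moves r \<Delta> \<gamma> (Board b k \<theta>)"
      then show "f q = f' q" using moving(3) IH by blast
    qed
    then show ?thesis by (simp only: moving(1))
  qed
qed

section \<open>The value of a game split at the token\<close>

text \<open>The board is held as two lists: the cells \<open>u\<close> behind the token and the cells \<open>v\<close> from the token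
onwards. This is what lets a reader of \<open>u\<close> and a reader of \<open>v\<close> be studied separately.\<close>

locale lap_game =
  fixes c :: convention and \<Delta> :: "'l::finite move_map" and \<gamma> :: "('l, nat) seed"
  assumes move_mapping: "move_mapping \<Delta>" and seed: "is_seed \<Delta> \<gamma>"
begin

abbreviation reach :: nat where
  "reach \<equiv> max_step \<Delta>"

definition stuck_value :: nat where
  "stuck_value = (case c of Normal \<Rightarrow> 0 | Misere \<Rightarrow> 1)"

text \<open>The value 0 at \<open>Blocked\<close> is arbitrary: no legal move ends there.\<close>

definition seed_number :: "nat \<Rightarrow> 'l \<Rightarrow> nat" where
  "seed_number i \<theta> = (case \<gamma> i \<theta> of Free h \<Rightarrow> h | Blocked \<Rightarrow> 0)"

text \<open>The content of the cell \<open>j\<close> places ahead of the token. A look past the end of the lap reads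
the start of the board, all of which lies in \<open>u\<close> when the board is longer than the maximal step.
Reading it through \<open>take reach u\<close> makes it depend on the first cells of \<open>u\<close> only, for arbitrary
arguments.\<close>

definition ahead :: "nat \<Rightarrow> cell list \<Rightarrow> cell list \<Rightarrow> nat \<Rightarrow> cell" where
  "ahead t u v j =
     (if j < length v then v ! j
      else if t = 0 then seed_content \<gamma> (Suc (j - length v))
      else take reach u ! (j - length v))"

text \<open>The SG value as a recursion that no longer mentions coordinates: \<open>t\<close> laps follow the current
one. A move either stays in the lap, where the cells passed go over to the prefix, or
starts the next lap on the updated board, or ends on the seed.\<close>

function lap_value :: "nat \<Rightarrow> cell list \<Rightarrow> cell list \<Rightarrow> 'l \<Rightarrow> nat" where
  "lap_value t u v \<theta> =
     (let A = legal_steps \<Delta> \<theta> (ahead t u v) in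
      if A = {} then stuck_value
      else mex ((\<lambda>(s, \<theta>').
             if s < length v then lap_value t (u @ take s (Obstacle # tl v)) (drop s v) \<theta>'
             else if t = 0 then seed_number (Suc (s - length v)) \<theta>'
             else lap_value (t - 1) (take (s - length v) (u @ Obstacle # tl v))
                    (drop (s - length v) (u @ Obstacle # tl v)) \<theta>') ` A))"
  by pat_completeness auto
termination
  by (relation "measures [\<lambda>(t, u, v, \<theta>). t, \<lambda>(t, u, v, \<theta>). length v]")
    (auto simp: legal_steps_def dest: steps_pos)

declare lap_value.simps [simp del]

definition lap_option :: "nat \<Rightarrow> cell list \<Rightarrow> cell list \<Rightarrow> nat \<Rightarrow> 'l \<Rightarrow> nat" where
  "lap_option t u v s \<theta> =
     (if s < length v then lap_value t (u @ take s (Obstacle # tl v)) (drop s v) \<theta>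
      else if t = 0 then seed_number (Suc (s - length v)) \<theta>
      else lap_value (t - 1) (take (s - length v) (u @ Obstacle # tl v))
             (drop (s - length v) (u @ Obstacle # tl v)) \<theta>)"

lemma lap_value_eq:
  "lap_value t u v \<theta> =
     (let A = legal_steps \<Delta> \<theta> (ahead t u v) in
      if A = {} then stuck_value else mex ((\<lambda>(s, \<theta>'). lap_option t u v s \<theta>') ` A))"
  by (subst lap_value.simps) (simp only: lap_option_def[abs_def])

lemma lap_value_cong:
  assumes ahead: "\<And>j. 0 < j \<Longrightarrow> j \<le> reach \<Longrightarrow> ahead t u v j = ahead t u' v' j"
    and option: "\<And>s \<theta>'. 0 < s \<Longrightarrow> s \<le> reach \<Longrightarrow> lap_option t u v s \<theta>' = lap_option t u' v' s \<theta>'"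
  shows "lap_value t u v \<theta> = lap_value t u' v' \<theta>"
proof -
  have A: "legal_steps \<Delta> \<theta> (ahead t u v) = legal_steps \<Delta> \<theta> (ahead t u' v')"
    by (rule legal_steps_cong[OF move_mapping ahead])
  have "(\<lambda>(s, \<theta>'). lap_option t u v s \<theta>') ` legal_steps \<Delta> \<theta> (ahead t u' v')
      = (\<lambda>(s, \<theta>'). lap_option t u' v' s \<theta>') ` legal_steps \<Delta> \<theta> (ahead t u' v')"
  proof (rule image_cong[OF refl], clarify)
    fix s \<theta>' assume "(s, \<theta>') \<in> legal_steps \<Delta> \<theta> (ahead t u' v')"
    then have "s \<in> steps \<Delta>" by (simp add: legal_steps_def)
    then show "lap_option t u v s \<theta>' = lap_option t u' v' s \<theta>'"
      by (intro option steps_pos step_le_max_step[OF move_mapping])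
  qed
  then show ?thesis
    unfolding lap_value_eq A Let_def by (simp only:)
qed

text \<open>A mex is at most the number of options, and 1 is the value of a stuck position in misere play.\<close>

definition value_bound :: nat where
  "value_bound = max 1 (card ({..reach} \<times> (UNIV :: 'l set)))"

lemma lap_value_le: "lap_value t u v \<theta> \<le> value_bound"
proof (cases "legal_steps \<Delta> \<theta> (ahead t u v) = {}")
  case True
  then show ?thesis
    by (simp add: lap_value_eq stuck_value_def value_bound_def split: convention.split)
next
  case False
  let ?A = "legal_steps \<Delta> \<theta> (ahead t u v)"
  let ?f = "\<lambda>(s, \<theta>'). lap_option t u v s \<theta>'"
  have "lap_value t u v \<theta> \<le> card (?f ` ?A)"
    using False finite_legal_steps[OF move_mapping] by (simp add: lap_value_eq mex_le_card)
  also have "\<dots> \<le> card ?A"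
    by (simp add: card_image_le finite_legal_steps[OF move_mapping])
  also have "\<dots> \<le> card ({..reach} \<times> (UNIV :: 'l set))"
    using step_le_max_step[OF move_mapping] by (intro card_mono) (auto simp: legal_steps_def)
  finally show ?thesis by (simp add: value_bound_def)
qed

text \<open>All that the next lap tells the current one: the values of a board when the token is on one of
the cells where a step across the lap boundary can land.\<close>

definition lap_values :: "nat \<Rightarrow> cell list \<Rightarrow> ('l \<Rightarrow> nat) list" where
  "lap_values t b = map (\<lambda>i. lap_value t (take i b) (drop i b)) [0..<Suc reach]"

lemma lap_values_nth: "i \<le> reach \<Longrightarrow> lap_values t b ! i = lap_value t (take i b) (drop i b)"
  by (simp add: lap_values_def del: upt_Suc)

lemma finite_value_functions: "finite {h :: 'l \<Rightarrow> nat. \<forall>\<theta>. h \<theta> \<le> value_bound}"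
  by (rule finite_functions_through[where \<rho> = id and Y = "{..value_bound}"]) auto

lemma finite_range_lap_values: "finite (range (lap_values t))"
proof (rule finite_subset)
  show "finite {hs. set hs \<subseteq> {h :: 'l \<Rightarrow> nat. \<forall>\<theta>. h \<theta> \<le> value_bound} \<and> length hs = Suc reach}"
    by (rule finite_lists_length_eq[OF finite_value_functions])
qed (auto simp: lap_values_def lap_value_le)


section \<open>Finitely many residuals, lap by lap\<close>

text \<open>In the last lap there is nothing to learn from a next one. A constant function keeps the
induction uniform.\<close>

definition next_lap_values :: "nat \<Rightarrow> cell list \<Rightarrow> ('l \<Rightarrow> nat) list" where
  "next_lap_values t = (if t = 0 then (\<lambda>_. []) else lap_values (t - 1))"

lemma finite_short_words: "finite {u :: cell list. length u \<le> m}"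
  using finite_lists_length_le[of "UNIV :: cell set" m] by simp

text \<open>The prefix matters in two ways only: cells of it are seen across the lap boundary, and it is
part of the board on which the next lap is played. Both hypotheses survive when the same cells
are appended to both prefixes, as a move does.\<close>

lemma lap_value_cong_prefix:
  assumes "take reach u = take reach u'"
    and "\<And>w. next_lap_values t (u @ w) = next_lap_values t (u' @ w)"
  shows "lap_value t u v \<theta> = lap_value t u' v \<theta>"
  using assms
proof (induction "length v" arbitrary: u u' v \<theta> rule: less_induct)
  case less
  show ?case
  proof (rule lap_value_cong)
    show "ahead t u v j = ahead t u' v j" for j
      using less.prems(1) by (simp add: ahead_def)
    fix s \<theta>' assume s: "0 < s" "s \<le> reach"
    show "lap_option t u v s \<theta>' = lap_option t u' v s \<theta>'"
    proof (cases "s < length v")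
      case True
      \<comment> \<open>Prefixes that agree on their first \<open>reach\<close> cells are equal or both at least that long.\<close>
      have "take reach (u @ x) = take reach (u' @ x)" for x
      proof (cases "length u < reach")
        case True
        then have "length u' < reach"
          using arg_cong[OF less.prems(1), of length] by simp
        then show ?thesis using True less.prems(1) by simp
      next
        case False
        then have "reach \<le> length u'"
          using arg_cong[OF less.prems(1), of length] by simp
        then show ?thesis using False less.prems(1) by simp
      qed
      then have "lap_value t (u @ x) (drop s v) \<theta>' = lap_value t (u' @ x) (drop s v) \<theta>'" for x
        using True s less.prems(2) by (intro less.hyps) simp_all
      then show ?thesis
        using True by (simp add: lap_option_def)
    next
      case False
      have "lap_value (t - 1) (take i (u @ w)) (drop i (u @ w))
          = lap_value (t - 1) (take i (u' @ w)) (drop i (u' @ w))" if "t \<noteq> 0" "i \<le> reach" for i w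
      proof -
        have "lap_values (t - 1) (u @ w) = lap_values (t - 1) (u' @ w)"
          using less.prems(2)[of w] that(1) by (simp add: next_lap_values_def)
        then show ?thesis using lap_values_nth[OF that(2)] by metis
      qed
      then show ?thesis
        using False s by (simp add: lap_option_def del: take_append drop_append)
    qed
  qed
qed

lemma finite_suffix_types:
  assumes "finite_residuals (next_lap_values t)"
  shows "finite (range (\<lambda>v u. lap_value t u v))"
proof (rule finite_functions_through)
  have "range (\<lambda>u. (take reach u, \<lambda>w. next_lap_values t (u @ w)))
      \<subseteq> {u. length u \<le> reach} \<times> range (\<lambda>u w. next_lap_values t (u @ w))"
    by auto
  then show "finite (range (\<lambda>u. (take reach u, \<lambda>w. next_lap_values t (u @ w))))"
    by (rule finite_subset) (use assms finite_short_words in \<open>simp add: finite_residuals_def\<close>)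
  show "finite {h :: 'l \<Rightarrow> nat. \<forall>\<theta>. h \<theta> \<le> value_bound}"
    by (rule finite_value_functions)
qed (auto simp: lap_value_le fun_eq_iff intro: lap_value_cong_prefix)

text \<open>While the token is in \<open>x\<close>, it sees no more of the suffix than its first \<open>reach\<close> cells, and when
it leaves \<open>x\<close> it lands at one of the first tails of the suffix. A suffix shorter
than that is known completely.\<close>

lemma lap_value_cong_suffix:
  assumes window: "take reach v = take reach v'"
    and types: "\<And>j u \<theta>. j \<le> reach \<Longrightarrow> lap_value t u (drop j v) \<theta> = lap_value t u (drop j v') \<theta>"
  shows "lap_value t u (x @ v) \<theta> = lap_value t u (x @ v') \<theta>"
proof (cases "length v < reach")
  case True
  then have "length v' < reach" using arg_cong[OF window, of length] by simp
  then show ?thesis using True window by simp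
next
  case False
  then have long: "reach \<le> length v" "reach \<le> length v'"
    using arg_cong[OF window, of length] by simp_all
  have same_take: "take i v = take i v'" if "i \<le> reach" for i
    using arg_cong[OF window, of "take i"] that by (simp add: min_absorb1)
  show ?thesis
  proof (induction "length x" arbitrary: u x \<theta> rule: less_induct)
    case less
    show ?case
    proof (cases "x = []")
      case True
      then show ?thesis using types[of 0] by simp
    next
      case False
      show ?thesis
      proof (rule lap_value_cong)
        fix j assume "0 < j" "j \<le> reach"
        then have j: "j < length (x @ v)" "j < length (x @ v')" "j < length x + reach"
          using False long by (cases x; simp)+
        have "(x @ v) ! j = (x @ take reach v) ! j" using j long by (simp add: nth_append)
        also have "\<dots> = (x @ v') ! j" using j long window by (simp add: nth_append)
        finally show "ahead t u (x @ v) j = ahead t u (x @ v') j"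
          using j by (simp add: ahead_def)
      next
        fix s \<theta>' assume s: "0 < s" "s \<le> reach"
        then have len: "s < length (x @ v)" "s < length (x @ v')"
          using False long by (cases x; simp)+
        have passed: "take s (Obstacle # tl (x @ v)) = take s (Obstacle # tl (x @ v'))"
          using s False same_take by (cases s) (simp_all add: take_Cons')
        have "lap_value t y (drop s (x @ v)) \<theta>' = lap_value t y (drop s (x @ v')) \<theta>'" for y
        proof (cases "s < length x")
          case True
          then show ?thesis using s less.hyps[of "drop s x" y \<theta>'] by simp
        next
          case False
          then show ?thesis using s types by simp
        qed
        then show "lap_option t u (x @ v) s \<theta>' = lap_option t u (x @ v') s \<theta>'"
          using len passed by (simp add: lap_option_def)
      qed
    qed
  qed
qed

text \<open>The step of the induction over laps. The next lap is read from left to right alongside the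
current one, whose own values are computed from right to left.\<close>

lemma finite_coresiduals_lap_values:
  assumes "finite_residuals (next_lap_values t)"
  shows "finite_coresiduals (lap_values t)"
  unfolding finite_coresiduals_def
proof (rule finite_range_if_determined)
  let ?type = "\<lambda>v u. lap_value t u v"
  let ?info = "\<lambda>v. (take reach v, map (\<lambda>j. ?type (drop j v)) [0..<Suc reach])"
  have "range ?info \<subseteq> {u. length u \<le> reach}
      \<times> {fs. set fs \<subseteq> range ?type \<and> length fs = Suc reach}"
    by auto
  moreover have "finite ({u :: cell list. length u \<le> reach}
      \<times> {fs. set fs \<subseteq> range ?type \<and> length fs = Suc reach})"
    by (intro finite_cartesian_product finite_short_words finite_lists_length_eq
        finite_suffix_types assms)
  ultimately show "finite (range ?info)" by (rule finite_subset)
  fix v v' assume info: "?info v = ?info v'"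
  then have window: "take reach v = take reach v'" by simp
  have types: "lap_value t u (drop j v) \<theta> = lap_value t u (drop j v') \<theta>" if "j \<le> reach" for j u \<theta>
  proof -
    have "\<forall>j \<in> set [0..<Suc reach]. ?type (drop j v) = ?type (drop j v')"
      using info unfolding prod.inject map_eq_conv by blast
    then show ?thesis using that by (simp del: upt_Suc add: fun_eq_iff)
  qed
  have same_take: "take i v = take i v'" if "i \<le> reach" for i
    using arg_cong[OF window, of "take i"] that by (simp add: min_absorb1)
  have "lap_value t (take i (u @ v)) (drop i (u @ v)) \<theta>
      = lap_value t (take i (u @ v')) (drop i (u @ v')) \<theta>" if "i \<le> reach" for i u \<theta>
  proof (cases "i < length u")
    case True
    then show ?thesis using lap_value_cong_suffix[OF window types] by simp
  next
    case False
    then show ?thesis using that types same_take by simp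
  qed
  then show "(\<lambda>u. lap_values t (u @ v)) = (\<lambda>u. lap_values t (u @ v'))"
    unfolding lap_values_def by (intro ext map_cong) auto
qed

lemma finite_residuals_lap_values: "finite_residuals (lap_values t)"
proof (induction t)
  case 0
  have "finite_residuals (next_lap_values 0)"
    by (simp add: finite_residuals_def next_lap_values_def)
  from finite_coresiduals_lap_values[OF this] show ?case
    by (rule finite_residuals_if_coresiduals) (rule finite_range_lap_values)
next
  case (Suc t)
  then have "finite_residuals (next_lap_values (Suc t))"
    by (simp add: next_lap_values_def)
  from finite_coresiduals_lap_values[OF this] show ?case
    by (rule finite_residuals_if_coresiduals) (rule finite_range_lap_values)
qed

text \<open>The starting cell is part of the board but not of the word, so the residuals at \<open>u\<close> are
governed by those of \<open>lap_values t\<close> at \<open>Empty # u\<close>. The length of \<open>u\<close> matters up to \<open>reach\<close> only.\<close>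

lemma regular_lap_value:
  "regular {w. reach < length w + 1 \<and> Q (lap_value t [] (Empty # w) \<theta>)}"
proof (rule regular_if_finite_residuals, unfold finite_residuals_def,
    rule finite_range_if_determined)
  let ?res = "\<lambda>u w. lap_values t (u @ w)"
  let ?info = "\<lambda>u. (min (length u) reach, ?res (Empty # u))"
  have "range ?info \<subseteq> {..reach} \<times> range ?res"
    by (auto intro: range_eqI[where x = "Empty # _"])
  then show "finite (range ?info)"
    by (rule finite_subset) (use finite_residuals_lap_values in \<open>simp add: finite_residuals_def\<close>)
  fix u u' assume info: "?info u = ?info u'"
  have "lap_value t [] (Empty # u @ w) = lap_value t [] (Empty # u' @ w)" for w
    using fun_cong[OF conjunct2[OF info[unfolded prod.inject]], of w]
      lap_values_nth[of 0 t "Empty # u @ w"] lap_values_nth[of 0 t "Empty # u' @ w"] by simp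
  moreover have "reach < length (u @ w) + 1 \<longleftrightarrow> reach < length (u' @ w) + 1" for w
    using info by (auto simp: min_def split: if_splits)
  ultimately show "(\<lambda>w. u @ w \<in> {w. reach < length w + 1 \<and> Q (lap_value t [] (Empty # w) \<theta>)})
      = (\<lambda>w. u' @ w \<in> {w. reach < length w + 1 \<and> Q (lap_value t [] (Empty # w) \<theta>)})"
    by simp
qed


section \<open>Laps of the unrolled board\<close>

lemma div_mod_add_same_lap:
  fixes k n s :: nat
  assumes "k mod n + s < n"
  shows "(k + s) div n = k div n" "(k + s) mod n = k mod n + s"
proof -
  define q m where "q = k div n" and "m = k mod n + s"
  have "k + s = q * n + m" by (simp add: q_def m_def)
  moreover have "m < n" using assms by (simp add: m_def)
  ultimately have "(k + s) div n = q" "(k + s) mod n = m" by simp_all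
  then show "(k + s) div n = k div n" "(k + s) mod n = k mod n + s"
    by (simp_all only: q_def m_def)
qed

lemma div_mod_add_next_lap:
  fixes k n s :: nat
  assumes "n \<le> k mod n + s" and "s < n"
  shows "(k + s) div n = Suc (k div n)" "(k + s) mod n = k mod n + s - n"
proof -
  define q m where "q = Suc (k div n)" and "m = k mod n + s - n"
  have "k mod n < n" using assms(2) by simp
  then have "m < n" using assms unfolding m_def by linarith
  have "k = k div n * n + k mod n" by simp
  then have "k + s = q * n + m" using assms(1) by (simp add: q_def m_def)
  then have "(k + s) div n = q" "(k + s) mod n = m" using \<open>m < n\<close> by simp_all
  then show "(k + s) div n = Suc (k div n)" "(k + s) mod n = k mod n + s - n"
    by (simp_all only: q_def m_def)
qed

text \<open>Every completed passage through the first \<open>reach\<close> cells has left an obstacle there: no step is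
long enough to jump over them. The token's own cell is empty until it is left, which makes the
obstacle left there a new one; so the passage counts only once the token is beyond these cells. Without the condition \<open>0 < reach\<close> the initial
position of a game that has no moves would be excluded.\<close>

definition lap_bounded :: "cell list \<Rightarrow> nat \<Rightarrow> bool" where
  "lap_bounded b k \<longleftrightarrow> b ! (k mod length b) = Empty \<and>
     k div length b + (if 0 < reach \<and> reach \<le> k mod length b then 1 else 0)
       \<le> card {i. i < reach \<and> b ! i = Obstacle}"

lemma lap_bounded_start: "lap_bounded (Empty # w) 0"
  by (auto simp: lap_bounded_def)

lemma lap_bounded_laps: "lap_bounded b k \<Longrightarrow> k div length b \<le> reach"
proof -
  assume "lap_bounded b k"
  moreover have "card {i. i < reach \<and> b ! i = Obstacle} \<le> card {..<reach}"
    by (rule card_mono) auto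
  ultimately show ?thesis by (auto simp: lap_bounded_def split: if_splits)
qed

lemma lap_bounded_step:
  assumes bounded: "lap_bounded b k" and long: "reach < length b"
    and s: "0 < s" "s \<le> reach" and free: "b ! ((k + s) mod length b) = Empty"
  shows "lap_bounded (b[k mod length b := Obstacle]) (k + s)"
proof -
  define n p where "n = length b" and "p = k mod n"
  let ?b = "b[p := Obstacle]"
  let ?count = "\<lambda>b. card {i. i < reach \<and> b ! i = Obstacle}"
  have n: "reach < n" using long by (simp add: n_def)
  have "p < n" using n by (simp add: p_def)
  have "b ! p = Empty"
    using bounded by (simp add: lap_bounded_def n_def p_def)
  note p = \<open>p < n\<close> this
  have here: "k div n + (if 0 < reach \<and> reach \<le> p then 1 else 0) \<le> ?count b"
    using bounded by (simp add: lap_bounded_def n_def p_def)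
  \<comment> \<open>Leaving one of the first cells adds an obstacle; beyond them it has been counted already.\<close>
  have marked: "k div n + 1 \<le> ?count ?b"
  proof (cases "reach \<le> p")
    case True
    then have "{i. i < reach \<and> ?b ! i = Obstacle} = {i. i < reach \<and> b ! i = Obstacle}"
      by auto
    then show ?thesis using here True s by simp
  next
    case False
    then have "{i. i < reach \<and> ?b ! i = Obstacle} = insert p {i. i < reach \<and> b ! i = Obstacle}"
      using p by (auto simp: n_def nth_list_update)
    then show ?thesis using here False p by simp
  qed
  have "(k + s) mod n \<noteq> p \<and>
      (k + s) div n + (if 0 < reach \<and> reach \<le> (k + s) mod n then 1 else 0) \<le> k div n + 1"
  proof (cases "p + s < n")
    case True
    then show ?thesis using div_mod_add_same_lap[of k n s] s by (simp add: p_def)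
  next
    case False
    then have "(k + s) div n = Suc (k div n)" and "(k + s) mod n = p + s - n"
      using div_mod_add_next_lap[of n k s] s n by (simp_all add: p_def)
    moreover have "p + s - n < p" and "p + s - n < reach"
      using False p n s by linarith+
    ultimately show ?thesis by simp
  qed
  then show ?thesis
    using marked free by (simp add: lap_bounded_def flip: n_def p_def)
qed

text \<open>Two moves may lead to the same position, so the values are given here per move, whereas the
inductive definition needs a function of positions. Uniqueness of values bridges the gap.\<close>

lemma has_sg_value_moving:
  assumes "legal_steps \<Delta> \<theta> (\<lambda>j. content r \<gamma> b (k + j)) = A" and "A \<noteq> {}"
    and options: "\<And>s \<theta>'. (s, \<theta>') \<in> A \<Longrightarrow>
      has_sg_value c r \<Delta> \<gamma>
        (if on_board r (length b) (k + s) then Board (b[k mod length b := Obstacle]) (k + s) \<theta>'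
         else Seeded (seed_index r (length b) (k + s)) \<theta>') (x s \<theta>')"
  shows "has_sg_value c r \<Delta> \<gamma> (Board b k \<theta>) (mex ((\<lambda>(s, \<theta>'). x s \<theta>') ` A))"
proof -
  define option where "option = (\<lambda>(s, \<theta>' :: 'l).
    if on_board r (length b) (k + s) then Board (b[k mod length b := Obstacle]) (k + s) \<theta>'
    else Seeded (seed_index r (length b) (k + s)) \<theta>')"
  define f where "f = (\<lambda>q. THE g. has_sg_value c r \<Delta> \<gamma> q g)"
  have moves: "moves r \<Delta> \<gamma> (Board b k \<theta>) = option ` A"
    using assms(1) by (simp add: option_def)
  have opt: "has_sg_value c r \<Delta> \<gamma> (option (s, \<theta>')) (x s \<theta>')" if "(s, \<theta>') \<in> A" for s \<theta>'
    using options[OF that] by (simp add: option_def)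
  have f: "f (option (s, \<theta>')) = x s \<theta>'" if "(s, \<theta>') \<in> A" for s \<theta>'
    unfolding f_def
  proof (rule the_equality)
    show "has_sg_value c r \<Delta> \<gamma> (option (s, \<theta>')) (x s \<theta>')" by (rule opt[OF that])
    show "g = x s \<theta>'" if "has_sg_value c r \<Delta> \<gamma> (option (s, \<theta>')) g" for g
      using has_sg_value_unique[OF that \<open>has_sg_value c r \<Delta> \<gamma> (option (s, \<theta>')) (x s \<theta>')\<close>] .
  qed
  have "has_sg_value c r \<Delta> \<gamma> (Board b k \<theta>) (mex (f ` moves r \<Delta> \<gamma> (Board b k \<theta>)))"
  proof (rule has_sg_value.moving)
    show "moves r \<Delta> \<gamma> (Board b k \<theta>) \<noteq> {}"
      unfolding moves using \<open>A \<noteq> {}\<close> by blast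
    show "\<forall>q \<in> moves r \<Delta> \<gamma> (Board b k \<theta>). has_sg_value c r \<Delta> \<gamma> q (f q)"
      unfolding moves
    proof (rule ballI, elim imageE)
      fix q a assume "q = option a" "a \<in> A"
      then show "has_sg_value c r \<Delta> \<gamma> q (f q)"
        using opt[of "fst a" "snd a"] f[of "fst a" "snd a"] by simp
    qed
  qed
  moreover have "f ` moves r \<Delta> \<gamma> (Board b k \<theta>) = (\<lambda>(s, \<theta>'). x s \<theta>') ` A"
    unfolding moves image_image
  proof (rule image_cong[OF refl])
    fix a assume "a \<in> A"
    then show "f (option a) = (case a of (s, \<theta>') \<Rightarrow> x s \<theta>')" using f by (cases a) simp
  qed
  ultimately show ?thesis by simp
qed

lemma seeded_value:
  assumes "seed_content \<gamma> i = Empty" "0 < i" "i \<le> reach"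
  shows "has_sg_value c r \<Delta> \<gamma> (Seeded i \<theta>) (seed_number i \<theta>)"
proof -
  have "(\<forall>\<theta>. \<gamma> i \<theta> = Blocked) \<or> (\<forall>\<theta>. \<gamma> i \<theta> \<noteq> Blocked)"
    using seed assms(2,3) by (simp add: is_seed_def)
  moreover have "\<not> (\<forall>\<theta>. \<gamma> i \<theta> = Blocked)"
  proof
    assume "\<forall>\<theta>. \<gamma> i \<theta> = Blocked"
    then have "seed_content \<gamma> i = Obstacle" by (simp add: seed_content_def)
    with assms(1) show False by simp
  qed
  ultimately have "\<gamma> i \<theta> \<noteq> Blocked" by blast
  then obtain h where "\<gamma> i \<theta> = Free h" by (cases "\<gamma> i \<theta>") auto
  then show ?thesis by (auto simp: seed_number_def intro: has_sg_value.seeded)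
qed

text \<open>The coordinate \<open>k\<close> is on lap \<open>k div n\<close> at cell \<open>k mod n\<close>, where \<open>n\<close> is the length of the board.
With infinitely many laps at most \<open>reach\<close> are ever completed, so \<open>reach + 2\<close> laps
in total keep even the look ahead away from the seed.\<close>

lemma has_sg_value_lap_value:
  assumes r: "r = enat (Suc T) \<or> r = \<infinity> \<and> T = Suc reach"
    and "reach < length b" and "k < Suc T * length b" and "lap_bounded b k"
  shows "has_sg_value c r \<Delta> \<gamma> (Board b k \<theta>)
    (lap_value (T - k div length b) (take (k mod length b) b) (drop (k mod length b) b) \<theta>)"
  using assms(2-)
proof (induction "Suc T * length b - k" arbitrary: b k \<theta> rule: less_induct)
  case less
  define n p t where "n = length b" and "p = k mod n" and "t = T - k div n"
  define u v where "u = take p b" and "v = drop p b"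
  have n: "reach < n" and k: "k < Suc T * n"
    using less.prems by (simp_all add: n_def)
  have p: "p < n" using n by (simp add: p_def)
  have laps: "k div n \<le> T" using k n by (metis less_Suc_eq_le less_mult_imp_div_less)
  have len: "length v = n - p" "length u = p" using p by (simp_all add: u_def v_def n_def)
  have v: "v \<noteq> []" using len p by auto
  have leave: "b[p := Obstacle] = u @ Obstacle # tl v"
    using p by (simp add: u_def v_def n_def upd_conv_take_nth_drop drop_Suc tl_drop)
  \<comment> \<open>For \<open>r = \<infinity>\<close> both sides hold, by the bound on the number of laps.\<close>
  have on: "on_board r n (k + j) \<longleftrightarrow> (k + j) div n \<le> T" if "j \<le> reach" for j
  proof (cases "r = \<infinity>")
    case True
    then have "k div n < T" using r lap_bounded_laps[OF less.prems(3)] by (simp add: n_def)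
    moreover have "(k + j) div n \<le> Suc (k div n)"
      using that n div_mod_add_same_lap(1)[of k n j] div_mod_add_next_lap(1)[of n k j]
      by (cases "k mod n + j < n") auto
    ultimately show ?thesis using True n by (auto simp: on_board_def)
  next
    case False
    then have "r = enat (Suc T)" using r by blast
    then have "on_board r n (k + j) \<longleftrightarrow> k + j < Suc T * n"
      by (simp add: on_board_def)
    also have "\<dots> \<longleftrightarrow> (k + j) div n < Suc T"
      using n by (simp add: div_less_iff_less_mult)
    finally show ?thesis by auto
  qed
  have index: "seed_index r n (k + j) = Suc (j - length v)"
    if "j \<le> reach" "length v \<le> j" "t = 0" for j
  proof -
    have "(k + j) div n = Suc (k div n)" and "(k + j) mod n = p + j - n"
      using div_mod_add_next_lap[of n k j] that n len by (auto simp: p_def)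
    moreover have T: "k div n = T" using that laps by (simp add: t_def)
    ultimately have "\<not> on_board r n (k + j)" using on that by simp
    then have "r = enat (Suc T)" using r n by (auto simp: on_board_def)
    moreover have "k + j = Suc T * n + (j - length v)"
    proof -
      have "k = T * n + p" using T by (metis div_mult_mod_eq p_def)
      then show ?thesis using that len p by simp
    qed
    ultimately show ?thesis by (simp add: seed_index_def)
  qed
  have ahead: "content r \<gamma> b (k + j) = ahead t u v j" if j: "0 < j" "j \<le> reach" for j
  proof (cases "j < length v")
    case True
    then have "(k + j) div n = k div n" "(k + j) mod n = p + j"
      using div_mod_add_same_lap[of k n j] len p by (simp_all add: p_def)
    then show ?thesis
      using on[OF j(2)] laps True p by (simp add: content_def ahead_def v_def flip: n_def)
  next
    case False
    then have nxt: "(k + j) div n = Suc (k div n)" "(k + j) mod n = p + j - n"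
      using div_mod_add_next_lap[of n k j] len p j n by (simp_all add: p_def)
    show ?thesis
    proof (cases "t = 0")
      case True
      then have "\<not> on_board r n (k + j)" using on[OF j(2)] nxt laps by (simp add: t_def)
      then show ?thesis
        using index[of j] j False True by (simp add: content_def ahead_def flip: n_def)
    next
      case t: False
      then have "on_board r n (k + j)" using on[OF j(2)] nxt by (simp add: t_def)
      moreover have "take reach u ! (j - length v) = b ! (p + j - n)"
      proof -
        have "j - length v = p + j - n" and "p + j - n < p" and "p + j - n < reach"
          using False j len p n by linarith+
        then show ?thesis by (simp only: u_def nth_take)
      qed
      ultimately show ?thesis
        using False t nxt by (simp add: content_def ahead_def flip: n_def)
    qed
  qed
  let ?A = "legal_steps \<Delta> \<theta> (ahead t u v)"
  have A: "legal_steps \<Delta> \<theta> (\<lambda>j. content r \<gamma> b (k + j)) = ?A"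
    by (rule legal_steps_cong[OF move_mapping ahead])
  show ?case
  proof (cases "?A = {}")
    case True
    then have "moves r \<Delta> \<gamma> (Board b k \<theta>) = {}" using A by simp
    then have "has_sg_value c r \<Delta> \<gamma> (Board b k \<theta>) stuck_value"
      unfolding stuck_value_def by (rule has_sg_value.stuck)
    then show ?thesis
      using True by (simp add: lap_value_eq flip: n_def p_def t_def u_def v_def)
  next
    case False
    have "has_sg_value c r \<Delta> \<gamma> (Board b k \<theta>) (mex ((\<lambda>(s, \<theta>'). lap_option t u v s \<theta>') ` ?A))"
    proof (rule has_sg_value_moving[OF A False])
      fix s \<theta>' assume "(s, \<theta>') \<in> ?A"
      then have "s \<in> steps \<Delta>" and "ahead t u v s = Empty"
        by (simp_all add: legal_steps_def)
      then have s: "0 < s" "s \<le> reach"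
        by (auto intro: steps_pos step_le_max_step[OF move_mapping])
      have free: "content r \<gamma> b (k + s) = Empty"
        using ahead[OF s] \<open>ahead t u v s = Empty\<close> by (rule trans)
      show "has_sg_value c r \<Delta> \<gamma>
        (if on_board r (length b) (k + s) then Board (b[k mod length b := Obstacle]) (k + s) \<theta>'
         else Seeded (seed_index r (length b) (k + s)) \<theta>') (lap_option t u v s \<theta>')"
      proof (cases "on_board r n (k + s)")
        case True
        let ?b = "b[p := Obstacle]"
        have "(k + s) div n \<le> T" using on s True by blast
        then have k': "k + s < Suc T * n"
          using n by (simp add: div_less_iff_less_mult flip: less_Suc_eq_le)
        have "b ! ((k + s) mod n) = Empty"
          using free True by (simp add: content_def flip: n_def)
        then have "lap_bounded ?b (k + s)"
          using lap_bounded_step[OF less.prems(3,1) s] by (simp add: p_def n_def)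
        then have ih: "has_sg_value c r \<Delta> \<gamma> (Board ?b (k + s) \<theta>')
            (lap_value (T - (k + s) div n) (take ((k + s) mod n) ?b) (drop ((k + s) mod n) ?b) \<theta>')"
          using less.hyps[of ?b "k + s" \<theta>'] k k' n s by (simp flip: n_def)
        have "lap_value (T - (k + s) div n) (take ((k + s) mod n) ?b) (drop ((k + s) mod n) ?b) \<theta>'
            = lap_option t u v s \<theta>'"
        proof (cases "s < length v")
          case True
          then have "(k + s) div n = k div n" "(k + s) mod n = p + s"
            using div_mod_add_same_lap[of k n s] len p by (simp_all add: p_def)
          moreover have "drop s (Obstacle # tl v) = drop s v"
            using s v by (cases s) (simp_all add: drop_Suc)
          ultimately show ?thesis
            using True len by (simp add: lap_option_def leave t_def)
        next
          case False
          then have "(k + s) div n = Suc (k div n)" "(k + s) mod n = s - length v"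
            using div_mod_add_next_lap[of n k s] len p s n by (simp_all add: p_def)
          moreover have "t \<noteq> 0"
            using \<open>(k + s) div n \<le> T\<close> calculation by (simp add: t_def)
          ultimately show ?thesis
            using False by (simp add: lap_option_def leave t_def)
        qed
        then show ?thesis using ih True by (simp flip: n_def p_def)
      next
        case off: False
        then have "T < (k + s) div n" using on s by auto
        then have pn: "n \<le> p + s"
          using div_mod_add_same_lap(1)[of k n s] laps by (cases "p + s < n") (auto simp: p_def)
        then have "(k + s) div n = Suc (k div n)"
          using div_mod_add_next_lap(1)[of n k s] s n by (simp add: p_def)
        then have "t = 0" using \<open>T < (k + s) div n\<close> by (simp add: t_def)
        have wrap: "length v \<le> s" using pn len by linarith
        have i: "seed_index r n (k + s) = Suc (s - length v)"
          by (rule index[OF s(2) wrap \<open>t = 0\<close>])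
        have "seed_content \<gamma> (Suc (s - length v)) = Empty"
          using free off i by (simp add: content_def flip: n_def)
        moreover have "Suc (s - length v) \<le> reach" using s wrap len p by linarith
        ultimately have "has_sg_value c r \<Delta> \<gamma> (Seeded (Suc (s - length v)) \<theta>')
            (seed_number (Suc (s - length v)) \<theta>')"
          by (intro seeded_value) auto
        then show ?thesis
          using off i wrap \<open>t = 0\<close> by (simp add: lap_option_def flip: n_def)
      qed
    qed
    then show ?thesis
      using False by (simp add: lap_value_eq flip: n_def p_def t_def u_def v_def)
  qed
qed

lemma has_sg_value_start:
  assumes "1 \<le> r"
  shows "\<exists>T. \<forall>w \<theta>. reach < length w + 1 \<longrightarrow>
    has_sg_value c r \<Delta> \<gamma> (start_position \<theta> w) (lap_value T [] (Empty # w) \<theta>)"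
proof -
  obtain T where T: "r = enat (Suc T) \<or> r = \<infinity> \<and> T = Suc reach"
  proof (cases r)
    case (enat m)
    then show ?thesis using assms that[of "m - 1"] by (cases m) (simp_all add: one_enat_def)
  qed (use that in blast)
  show ?thesis
  proof (intro exI allI impI)
    fix w :: "cell list" and \<theta> assume w: "reach < length w + 1"
    then show "has_sg_value c r \<Delta> \<gamma> (start_position \<theta> w) (lap_value T [] (Empty # w) \<theta>)"
      using has_sg_value_lap_value[OF T, of "Empty # w" 0 \<theta>] lap_bounded_start[of w]
      by (simp add: start_position_def)
  qed
qed

lemma regular_SG_words:
  assumes "1 \<le> r"
  shows "regular (SG_words c r \<Delta> \<gamma> \<theta> g)"
proof -
  obtain T where T: "\<And>(w :: cell list) \<theta>. reach < length w + 1 \<Longrightarrow>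
      has_sg_value c r \<Delta> \<gamma> (start_position \<theta> w) (lap_value T [] (Empty # w) \<theta>)"
    using has_sg_value_start[OF assms] by blast
  have "has_sg_value c r \<Delta> \<gamma> (start_position \<theta> w) g \<longleftrightarrow> lap_value T [] (Empty # w) \<theta> = g"
    if "reach < length w + 1" for w
    using T[OF that] has_sg_value_unique by metis
  then have "SG_words c r \<Delta> \<gamma> \<theta> g
      = {w. reach < length w + 1 \<and> lap_value T [] (Empty # w) \<theta> = g}"
    unfolding SG_words_def by auto
  then show ?thesis using regular_lap_value[of "\<lambda>x. x = g"] by simp
qed

end


section \<open>Outcomes as zero and nonzero SG values\<close>

text \<open>The subscript of a seed cell tells how the player fares who moves onto it. So the subscript \<open>N\<close>
is good for the mover and acts like a position of value 0, a \<open>P\<close>-position for the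
opponent; the subscript \<open>P\<close> acts like an \<open>N\<close>-position for the opponent.\<close>

fun outcome_number :: "outcome \<Rightarrow> nat" where
  "outcome_number Outcome_N = 0"
| "outcome_number Outcome_P = 1"

definition numeric_seed :: "('l, outcome) seed \<Rightarrow> ('l, nat) seed" where
  "numeric_seed \<gamma> i \<theta> = map_seed_value outcome_number (\<gamma> i \<theta>)"

lemma numeric_seed_Blocked_iff: "numeric_seed \<gamma> i \<theta> = Blocked \<longleftrightarrow> \<gamma> i \<theta> = Blocked"
  by (cases "\<gamma> i \<theta>") (simp_all add: numeric_seed_def)

lemma is_seed_numeric: "is_seed \<Delta> \<gamma> \<Longrightarrow> is_seed \<Delta> (numeric_seed \<gamma>)"
  by (simp only: is_seed_def numeric_seed_Blocked_iff)

lemma moves_numeric: "moves r \<Delta> (numeric_seed \<gamma>) p = moves r \<Delta> \<gamma> p"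
proof -
  have "content r (numeric_seed \<gamma>) = content r \<gamma>"
    by (simp only: fun_eq_iff content_def seed_content_def numeric_seed_Blocked_iff) simp
  then show ?thesis by (cases p) simp_all
qed

lemma finite_moves:
  fixes \<Delta> :: "'l::finite move_map"
  shows "move_mapping \<Delta> \<Longrightarrow> finite (moves r \<Delta> \<gamma> p)"
  by (cases p) (simp_all add: finite_legal_steps)

locale outcome_game =
  fixes c :: convention and r :: enat and \<Delta> :: "'l::finite move_map" and \<gamma> :: "('l, outcome) seed"
  assumes move_mapping: "move_mapping \<Delta>"
begin

abbreviation M :: "'l position \<Rightarrow> 'l position set" where
  "M \<equiv> moves r \<Delta> \<gamma>"

abbreviation val :: "'l position \<Rightarrow> nat \<Rightarrow> bool" where
  "val \<equiv> has_sg_value c r \<Delta> (numeric_seed \<gamma>)"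

lemma val_terminal:
  assumes "val p g" and "M p = {}"
  shows "previous_player_wins c \<gamma> p \<longleftrightarrow> g = 0"
  using assms(1)
proof cases
  case (seeded i \<theta>)
  then obtain out where "\<gamma> i \<theta> = Free out" "g = outcome_number out"
    by (cases "\<gamma> i \<theta>") (auto simp: numeric_seed_def)
  then show ?thesis using seeded(1) by (cases out) simp_all
next
  case (stuck b k \<theta>)
  then show ?thesis by (cases c) simp_all
next
  case (moving b k \<theta> f)
  then show ?thesis using assms(2) by (simp only: moves_numeric)
qed

text \<open>A position with options has value 0 exactly if none of the options has: a mex is 0 exactly if 0
is missing. This is the recursion of outcomes, also under the misere convention.\<close>

lemma val_of_moves:
  assumes "val p g" and "M p \<noteq> {}"
  obtains f where "\<And>q. q \<in> M p \<Longrightarrow> val q (f q)" and "g = 0 \<longleftrightarrow> 0 \<notin> f ` M p"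
  using assms(1)
proof cases
  case (seeded i \<theta>)
  then show ?thesis using assms(2) by simp
next
  case (stuck b k \<theta>)
  then show ?thesis using assms(2) by (simp only: moves_numeric)
next
  case (moving b k \<theta> f)
  show ?thesis
  proof (rule that[of f])
    show "val q (f q)" if "q \<in> M p" for q
      using moving(1,4) that by (simp only: moves_numeric)
    show "g = 0 \<longleftrightarrow> 0 \<notin> f ` M p"
      unfolding moving(1,2) moves_numeric
      by (rule mex_eq_0_iff) (simp only: finite_imageI finite_moves[OF move_mapping])
  qed
qed

text \<open>The first player moves to an option of value 0 whenever there is one. Then the positions
in which the first player is to move keep nonzero values, and those of the opponent value 0.\<close>

lemma N_position_if_nonzero:
  assumes "val p g" and "g \<noteq> 0"
  shows "N_position c r \<Delta> \<gamma> p"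
proof -
  define good where "good = (\<lambda>h q. q \<in> M (last h) \<and> val q 0)"
  define \<sigma> where "\<sigma> = (\<lambda>h. if \<exists>q. good h q then SOME q. good h q else SOME q. q \<in> M (last h))"
  have \<sigma>_good: "good h (\<sigma> h)" if "\<exists>q. good h q" for h
    using someI_ex[OF that] that by (simp add: \<sigma>_def)
  have \<sigma>_any: "\<sigma> h \<in> M (last h)" if "M (last h) \<noteq> {}" for h
  proof (cases "\<exists>q. good h q")
    case True
    from \<sigma>_good[OF this] show ?thesis by (simp only: good_def)
  next
    case False
    then have "\<sigma> h = (SOME q. q \<in> M (last h))"
      unfolding \<sigma>_def by (rule if_not_P)
    then show ?thesis using that by (simp add: some_in_eq)
  qed
  then have "legal_strategy r \<Delta> \<gamma> \<sigma>"
    by (simp only: legal_strategy_def) blast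
  moreover have "first_player_wins c \<gamma> ps"
    if play: "complete_play r \<Delta> \<gamma> p ps" and follows: "first_player_follows \<sigma> ps" for ps
  proof -
    have ps: "ps \<noteq> []" "hd ps = p" "M (last ps) = {}"
      and step: "\<And>j. Suc j < length ps \<Longrightarrow> ps ! Suc j \<in> M (ps ! j)"
      using play by (simp_all only: complete_play_def) blast+
    have inv: "\<exists>g. val (ps ! j) g \<and> (g = 0 \<longleftrightarrow> odd j)" if "j < length ps" for j
      using that
    proof (induction j)
      case 0
      then show ?case using assms ps by (auto simp: hd_conv_nth)
    next
      case (Suc j)
      then obtain g where g: "val (ps ! j) g" "g = 0 \<longleftrightarrow> odd j" by auto
      have mem: "ps ! Suc j \<in> M (ps ! j)" using step Suc.prems by blast
      then obtain f where f: "\<And>q. q \<in> M (ps ! j) \<Longrightarrow> val q (f q)" "g = 0 \<longleftrightarrow> 0 \<notin> f ` M (ps ! j)"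
        using val_of_moves[OF g(1)] by blast
      show ?case
      proof (cases "odd j")
        case True
        then have "f (ps ! Suc j) \<noteq> 0" using f(2) g(2) mem by force
        then show ?thesis using f(1)[OF mem] True by auto
      next
        case False
        let ?h = "take (Suc j) ps"
        have last: "last ?h = ps ! j" using Suc.prems by (simp add: take_Suc_conv_app_nth)
        obtain q where "q \<in> M (ps ! j)" "f q = 0" using False f(2) g(2) by force
        then have "good ?h q" using f(1)[of q] last by (simp add: good_def)
        then have "good ?h (\<sigma> ?h)" using \<sigma>_good by blast
        moreover have "ps ! Suc j = \<sigma> ?h"
          using follows False Suc.prems by (simp add: first_player_follows_def)
        ultimately have "val (ps ! Suc j) 0" by (simp add: good_def)
        then show ?thesis using False by auto
      qed
    qed
    obtain g' where "val (last ps) g'" "g' = 0 \<longleftrightarrow> odd (length ps - 1)"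
      using inv[of "length ps - 1"] ps(1) by (auto simp: last_conv_nth)
    then show ?thesis
      using val_terminal[OF _ ps(3)] by (simp add: first_player_wins_def)
  qed
  ultimately show ?thesis by (auto simp: N_position_def)
qed

text \<open>Strategies may depend on the history, so the plays against a given strategy are built as
growing histories.\<close>

definition partial_play :: "('l position list \<Rightarrow> 'l position) \<Rightarrow> 'l position \<Rightarrow> 'l position list \<Rightarrow> bool" where
  "partial_play \<sigma> p h \<longleftrightarrow> h \<noteq> [] \<and> hd h = p \<and>
     (\<forall>j. Suc j < length h \<longrightarrow> h ! Suc j \<in> M (h ! j)) \<and> first_player_follows \<sigma> h"

lemma partial_play_snoc:
  assumes h: "partial_play \<sigma> p h" and q: "q \<in> M (last h)" and \<sigma>: "odd (length h) \<Longrightarrow> q = \<sigma> h"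
  shows "partial_play \<sigma> p (h @ [q])"
proof -
  have ne: "h \<noteq> []" using h by (simp add: partial_play_def)
  have "(h @ [q]) ! Suc j \<in> M ((h @ [q]) ! j)" if "Suc j < length (h @ [q])" for j
  proof (cases "Suc j < length h")
    case True
    then show ?thesis using h by (simp add: partial_play_def nth_append)
  next
    case False
    then have "Suc j = length h" using that by simp
    then show ?thesis using q ne by (simp add: nth_append last_conv_nth flip: \<open>Suc j = length h\<close>)
  qed
  moreover have "(h @ [q]) ! Suc j = \<sigma> (take (Suc j) (h @ [q]))"
    if "even j" "Suc j < length (h @ [q])" for j
  proof (cases "Suc j < length h")
    case True
    then show ?thesis
      using h that by (simp add: partial_play_def first_player_follows_def nth_append)
  next
    case False
    then have j: "Suc j = length h" using that by simp
    then have "odd (length h)" using that(1) by (metis even_Suc)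
    then show ?thesis using \<sigma> j by (simp add: nth_append)
  qed
  ultimately show ?thesis
    using h by (simp add: partial_play_def first_player_follows_def)
qed

text \<open>Against an arbitrary strategy the opponent answers with options of value 0. The parity
hypothesis says that the value is 0 exactly when the first player is to move. The induction
follows the derivation of the value, which also bounds the length of the play.\<close>

lemma losing_play:
  assumes \<sigma>: "legal_strategy r \<Delta> \<gamma> \<sigma>"
    and "val q g" and "partial_play \<sigma> p h" and "last h = q" and "g = 0 \<longleftrightarrow> odd (length h)"
  shows "\<exists>ps. complete_play r \<Delta> \<gamma> p ps \<and> first_player_follows \<sigma> ps \<and> \<not> first_player_wins c \<gamma> ps"
proof -
  have finished: ?thesis
    if "val (last h) g" "M (last h) = {}" "partial_play \<sigma> p h" "g = 0 \<longleftrightarrow> odd (length h)" for h g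
  proof (intro exI conjI)
    show "complete_play r \<Delta> \<gamma> p h" "first_player_follows \<sigma> h"
      using that by (simp_all add: complete_play_def partial_play_def)
    have "h \<noteq> []" using that(3) by (simp add: partial_play_def)
    then have "odd (length h - 1) \<longleftrightarrow> even (length h)" by (cases h) simp_all
    then show "\<not> first_player_wins c \<gamma> h"
      using val_terminal[OF that(1,2)] that(4) by (simp add: first_player_wins_def)
  qed
  show ?thesis
    using assms(2-)
  proof (induction arbitrary: h rule: has_sg_value.induct)
    case (seeded i \<theta> g)
    show ?case
    proof (rule finished)
      show "val (last h) g"
        unfolding seeded.prems(2) using seeded.hyps by (rule has_sg_value.seeded)
      show "M (last h) = {}" unfolding seeded.prems(2) by simp
    qed (use seeded.prems in blast)+
  next
    case (stuck b k \<theta>)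
    show ?case
    proof (rule finished)
      show "val (last h) (case c of Normal \<Rightarrow> 0 | Misere \<Rightarrow> 1)"
        unfolding stuck.prems(2) using stuck.hyps by (rule has_sg_value.stuck)
      show "M (last h) = {}"
        using stuck.hyps unfolding stuck.prems(2) by (simp only: moves_numeric)
    qed (use stuck.prems in blast)+
  next
    case (moving b k \<theta> f)
    let ?p = "Board b k \<theta>"
    let ?g = "mex (f ` moves r \<Delta> (numeric_seed \<gamma>) ?p)"
    have ne: "M (last h) \<noteq> {}"
      using moving.hyps unfolding moving.prems(2) by (simp only: moves_numeric not_False_eq_True)
    have zero: "?g = 0 \<longleftrightarrow> 0 \<notin> f ` M (last h)"
      unfolding moving.prems(2) moves_numeric
      by (rule mex_eq_0_iff) (simp only: finite_imageI finite_moves[OF move_mapping])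
    have h: "h \<noteq> []" using moving.prems(1) by (simp add: partial_play_def)
    have parity: "0 \<in> f ` M (last h) \<longleftrightarrow> even (length h)"
      using zero moving.prems(3) by argo
    obtain q where q: "q \<in> M (last h)" "odd (length h) \<Longrightarrow> q = \<sigma> h"
      "even (length h) \<Longrightarrow> f q = 0"
    proof (cases "odd (length h)")
      case True
      have "\<sigma> h \<in> M (last h)" using \<sigma> h ne by (simp only: legal_strategy_def) blast
      then show ?thesis using that True by blast
    next
      case False
      then have "0 \<in> f ` M (last h)" using parity by simp
      then show ?thesis using that False by (metis imageE)
    qed
    have "f q = 0 \<longleftrightarrow> odd (length (h @ [q]))"
    proof (cases "odd (length h)")
      case True
      then have "0 \<notin> f ` M (last h)" using parity by simp
      then have "f q \<noteq> 0" using q(1) by (metis imageI)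
      then show ?thesis using True by simp
    next
      case False
      then show ?thesis using q(3) by simp
    qed
    moreover have "partial_play \<sigma> p (h @ [q])"
      by (rule partial_play_snoc[OF moving.prems(1) q(1,2)])
    moreover have "q \<in> moves r \<Delta> (numeric_seed \<gamma>) ?p"
      using q(1) unfolding moving.prems(2) by (simp only: moves_numeric)
    ultimately show ?case using moving.IH by (metis last_snoc)
  qed
qed

lemma N_position_iff_nonzero:
  assumes "val p g"
  shows "N_position c r \<Delta> \<gamma> p \<longleftrightarrow> g \<noteq> 0"
proof
  assume "N_position c r \<Delta> \<gamma> p"
  then obtain \<sigma> where \<sigma>: "legal_strategy r \<Delta> \<gamma> \<sigma>"
    and wins: "\<And>ps. complete_play r \<Delta> \<gamma> p ps \<Longrightarrow> first_player_follows \<sigma> ps \<Longrightarrow> first_player_wins c \<gamma> ps"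
    by (auto simp: N_position_def)
  show "g \<noteq> 0"
  proof
    assume "g = 0"
    moreover have "partial_play \<sigma> p [p]"
      by (simp add: partial_play_def first_player_follows_def)
    ultimately obtain ps where "complete_play r \<Delta> \<gamma> p ps" "first_player_follows \<sigma> ps"
      "\<not> first_player_wins c \<gamma> ps"
      using losing_play[OF \<sigma> assms, of p "[p]"] by auto
    then show False using wins by blast
  qed
qed (rule N_position_if_nonzero[OF assms])

end

lemma regular_outcome_words:
  fixes \<Delta> :: "'l::finite move_map"
  assumes "move_mapping \<Delta>" and "is_seed \<Delta> \<gamma>" and "1 \<le> r"
  shows "regular (N_words c r \<Delta> \<gamma> \<theta>)" and "regular (P_words c r \<Delta> \<gamma> \<theta>)"
proof -
  interpret numeric: lap_game c \<Delta> "numeric_seed \<gamma>"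
    using assms by unfold_locales (auto intro: is_seed_numeric)
  interpret outcome_game c r \<Delta> \<gamma>
    using assms by unfold_locales
  obtain T where T: "\<forall>w \<theta>. max_step \<Delta> < length w + 1 \<longrightarrow>
      val (start_position \<theta> w) (numeric.lap_value T [] (Empty # w) \<theta>)"
    using numeric.has_sg_value_start[OF assms(3)] by blast
  have N: "N_position c r \<Delta> \<gamma> (start_position \<theta> w) \<longleftrightarrow> numeric.lap_value T [] (Empty # w) \<theta> \<noteq> 0"
    if "max_step \<Delta> < length w + 1" for w
    using T that by (intro N_position_iff_nonzero) blast
  have "N_words c r \<Delta> \<gamma> \<theta>
      = {w. max_step \<Delta> < length w + 1 \<and> numeric.lap_value T [] (Empty # w) \<theta> \<noteq> 0}"
    unfolding N_words_def by (rule Collect_cong) (use N in blast)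
  then show "regular (N_words c r \<Delta> \<gamma> \<theta>)"
    using numeric.regular_lap_value[of "\<lambda>g. g \<noteq> 0"] by simp
  have "P_words c r \<Delta> \<gamma> \<theta>
      = {w. max_step \<Delta> < length w + 1 \<and> numeric.lap_value T [] (Empty # w) \<theta> = 0}"
    unfolding P_words_def P_position_def by (rule Collect_cong) (use N in blast)
  then show "regular (P_words c r \<Delta> \<gamma> \<theta>)"
    using numeric.regular_lap_value[of "\<lambda>g. g = 0"] by simp
qed

lemma regular_SG_words:
  fixes \<Delta> :: "'l::finite move_map"
  assumes "move_mapping \<Delta>" and "is_seed \<Delta> \<gamma>" and "1 \<le> r"
  shows "regular (SG_words c r \<Delta> \<gamma> \<theta> g)"
  using assms by (intro lap_game.regular_SG_words lap_game.intro)


section \<open>Kotzig's nim\<close>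

lemma is_seed_no_seed: "is_seed \<Delta> no_seed"
  by (simp add: is_seed_def no_seed_def)

lemma move_mapping_impartial:
  assumes "finite S"
  shows "move_mapping (impartial_moves S)"
  unfolding move_mapping_def
proof (rule finite_subset[OF _ assms], rule subsetI)
  fix s assume "s \<in> steps (impartial_moves S)"
  then obtain v \<theta> where "s = length (v @ [Empty])" "impartial_moves S \<theta> (v @ [Empty]) \<noteq> {}"
    unfolding steps_def by blast
  then show "s \<in> S" by (cases \<theta>) (auto split: if_splits)
qed

lemma move_mapping_partizan:
  assumes "finite S\<^sub>L" and "finite S\<^sub>R"
  shows "move_mapping (partizan_moves S\<^sub>L S\<^sub>R)"
  unfolding move_mapping_def
proof (rule finite_subset)
  show "finite (S\<^sub>L \<union> S\<^sub>R)" using assms by simp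
  show "steps (partizan_moves S\<^sub>L S\<^sub>R) \<subseteq> S\<^sub>L \<union> S\<^sub>R"
  proof
    fix s assume "s \<in> steps (partizan_moves S\<^sub>L S\<^sub>R)"
    then obtain v \<theta> where
      "s = length (v @ [Empty])" "partizan_moves S\<^sub>L S\<^sub>R \<theta> (v @ [Empty]) \<noteq> {}"
      unfolding steps_def by blast
    then show "s \<in> S\<^sub>L \<union> S\<^sub>R" by (cases \<theta>) (auto split: if_splits)
  qed
qed

theorem theorem4p3:
  fixes \<Delta> :: "'l::finite move_map" and \<theta>\<^sub>0 :: 'l and r :: enat
  assumes "move_mapping \<Delta>" and "r \<ge> 1"
  shows
    "(\<forall>\<gamma> c. is_seed \<Delta> \<gamma> \<longrightarrow>
        regular (N_words c r \<Delta> \<gamma> \<theta>\<^sub>0) \<and> regular (P_words c r \<Delta> \<gamma> \<theta>\<^sub>0)) \<and>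
     (\<forall>m \<gamma> c g. move_bound \<Delta> m \<and> is_sg_seed \<Delta> m \<gamma> \<longrightarrow>
        regular (SG_words c r \<Delta> \<gamma> \<theta>\<^sub>0 g)) \<and>
     (\<forall>S c. finite S \<and> 0 \<notin> S \<longrightarrow>
        regular (N_words c \<infinity> (impartial_moves S) no_seed Token) \<and>
        regular (P_words c \<infinity> (impartial_moves S) no_seed Token) \<and>
        (\<forall>g. regular (SG_words c \<infinity> (impartial_moves S) no_seed Token g))) \<and>
     (\<forall>S\<^sub>L S\<^sub>R c t. finite S\<^sub>L \<and> 0 \<notin> S\<^sub>L \<and> finite S\<^sub>R \<and> 0 \<notin> S\<^sub>R \<longrightarrow>
        regular (N_words c \<infinity> (partizan_moves S\<^sub>L S\<^sub>R) no_seed t) \<and>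
        regular (P_words c \<infinity> (partizan_moves S\<^sub>L S\<^sub>R) no_seed t) \<and>
        (\<forall>g. regular (SG_words c \<infinity> (partizan_moves S\<^sub>L S\<^sub>R) no_seed t g)))"
proof (intro conjI allI impI)
  fix \<gamma> :: "('l, outcome) seed" and c
  assume "is_seed \<Delta> \<gamma>"
  then show "regular (N_words c r \<Delta> \<gamma> \<theta>\<^sub>0)" "regular (P_words c r \<Delta> \<gamma> \<theta>\<^sub>0)"
    using assms by (auto intro: regular_outcome_words)
next
  fix m c g and \<gamma> :: "('l, nat) seed"
  assume "move_bound \<Delta> m \<and> is_sg_seed \<Delta> m \<gamma>"
  then have "is_seed \<Delta> \<gamma>" by (simp add: is_sg_seed_def)
  then show "regular (SG_words c r \<Delta> \<gamma> \<theta>\<^sub>0 g)"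
    using assms by (auto intro: regular_SG_words)
next
  fix S :: "nat set" and c g
  assume "finite S \<and> 0 \<notin> S"
  then have "move_mapping (impartial_moves S)" by (simp add: move_mapping_impartial)
  then show "regular (N_words c \<infinity> (impartial_moves S) no_seed Token)"
    "regular (P_words c \<infinity> (impartial_moves S) no_seed Token)"
    "regular (SG_words c \<infinity> (impartial_moves S) no_seed Token g)"
    by (simp_all add: regular_outcome_words regular_SG_words is_seed_no_seed)
next
  fix S\<^sub>L S\<^sub>R :: "nat set" and c t g
  assume "finite S\<^sub>L \<and> 0 \<notin> S\<^sub>L \<and> finite S\<^sub>R \<and> 0 \<notin> S\<^sub>R"
  then have "move_mapping (partizan_moves S\<^sub>L S\<^sub>R)" by (simp add: move_mapping_partizan)
  then show "regular (N_words c \<infinity> (partizan_moves S\<^sub>L S\<^sub>R) no_seed t)"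
    "regular (P_words c \<infinity> (partizan_moves S\<^sub>L S\<^sub>R) no_seed t)"
    "regular (SG_words c \<infinity> (partizan_moves S\<^sub>L S\<^sub>R) no_seed t g)"
    by (simp_all add: regular_outcome_words regular_SG_words is_seed_no_seed)
qed

end
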